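(* Let $(X,\|\cdot\|)$ be a Banach space, let $p\ge1$ be real, let $\alpha_1,\alpha_2>0$ with $\alpha_1+\alpha_2=1$, and let $C\subset X$ be nonempty, closed, bounded and convex such that $(C^2,\|\cdot\|_{\alpha,p})$ has the fixed point property for nonexpansive maps. If $T:C\to C$ is $((\alpha_1,\alpha_2),p)$-nonexpansive, then there exist points $x,y\in C$ such that $$T(\alpha_1x+\alpha_2y)=x\quad\text{and}\quad T^2(\alpha_1x+\alpha_2y)=y .$$ In particular, these points satisfy $Tx=y$ and $T(\alpha_1x+\alpha_2Tx)=x$; that is, $\tau_\alpha:=T\circ(\alpha_1I+\alpha_2T)$ has a fixed point.
   Context: For $p\in[1,\infty)$, a map $T:C\to C$ is $((\alpha_1,\alpha_2),p)$-nonexpansive if $\alpha_1\|Tx-Ty\|^p+\alpha_2\|T^2x-T^2y\|^p\le\|x-y\|^p$ for all $x,y\in C$, where $T^2=T\circ T$. The norm $\|\cdot\|_{\alpha,p}$ on $X^2$ is $\|(x,y)\|_{\alpha,p}:=(\alpha_1\|x\|^p+\alpha_2\|y\|^p)^{1/p}$. The set $(C^2,\|\cdot\|_{\alpha,p})$ has the fixed point property for nonexpansive maps if every map $J:C^2\to C^2$ that is nonexpansive (i.e. $1$-Lipschitz) with respect to $\|\cdot\|_{\alpha,p}$ has a fixed point. $I$ is the identity map. *)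

theory Defs
  imports "HOL-Analysis.Analysis"
begin

text \<open>
  A self-map of a set \<open>C\<close> is rendered as a total function together with the condition
  \<open>T \<in> C \<rightarrow> C\<close>; the values outside \<open>C\<close> are never inspected by the notions below.
\<close>

definition mean_nonexpansive_on ::
    "real \<Rightarrow> real \<Rightarrow> real \<Rightarrow> 'a::real_normed_vector set \<Rightarrow> ('a \<Rightarrow> 'a) \<Rightarrow> bool" where
  "mean_nonexpansive_on \<alpha>1 \<alpha>2 p C T \<longleftrightarrow>
     T \<in> C \<rightarrow> C \<and>
     (\<forall>x\<in>C. \<forall>y\<in>C.
        \<alpha>1 * norm (T x - T y) powr p + \<alpha>2 * norm ((T \<circ> T) x - (T \<circ> T) y) powr p
          \<le> norm (x - y) powr p)"

text \<open>The weighted \<open>p\<close>-norm on the product, distinct from the library's Euclidean product norm.\<close>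

definition weighted_norm ::
    "real \<Rightarrow> real \<Rightarrow> real \<Rightarrow> 'a::real_normed_vector \<times> 'a \<Rightarrow> real" where
  "weighted_norm \<alpha>1 \<alpha>2 p u =
     (\<alpha>1 * norm (fst u) powr p + \<alpha>2 * norm (snd u) powr p) powr (1 / p)"

definition nonexpansive_wrt ::
    "('b::ab_group_add \<Rightarrow> real) \<Rightarrow> 'b set \<Rightarrow> ('b \<Rightarrow> 'b) \<Rightarrow> bool" where
  "nonexpansive_wrt N D J \<longleftrightarrow> (\<forall>u\<in>D. \<forall>v\<in>D. N (J u - J v) \<le> N (u - v))"

definition fixed_point_property ::
    "('b::ab_group_add \<Rightarrow> real) \<Rightarrow> 'b set \<Rightarrow> bool" where
  "fixed_point_property N D \<longleftrightarrow>
     (\<forall>J. J \<in> D \<rightarrow> D \<and> nonexpansive_wrt N D J \<longrightarrow> (\<exists>u\<in>D. J u = u))"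

definition tau ::
    "real \<Rightarrow> real \<Rightarrow> ('a::real_vector \<Rightarrow> 'a) \<Rightarrow> 'a \<Rightarrow> 'a" where
  "tau \<alpha>1 \<alpha>2 T = T \<circ> (\<lambda>x. \<alpha>1 *\<^sub>R x + \<alpha>2 *\<^sub>R T x)"

end

theory Submission
  imports Defs
begin

text \<open>
  On \<open>C \<times> C\<close> the map \<open>(x, y) \<mapsto> (T z, T\<^sup>2 z)\<close> with \<open>z = \<alpha>1 x + \<alpha>2 y\<close> is nonexpansive: mean
  nonexpansiveness bounds the \<open>p\<close>-th power of the distance of the images by the \<open>p\<close>-th power of
  \<open>\<parallel>z - w\<parallel>\<close>, and convexity of \<open>t \<mapsto> t\<^sup>p\<close> bounds the latter by the \<open>p\<close>-th power of the distance of
  the arguments. A fixed point \<open>(x, y)\<close> then satisfies \<open>T x = T (T z) = y\<close>.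
\<close>

text \<open>For positive \<open>r\<close> and \<open>s\<close> this is convexity of the power
  function. If one of them is 0, its summand vanishes on both sides and \<open>scale\<close> bounds
  the other one.\<close>

lemma powr_convex_combination_le:
  fixes a b r s p :: real
  assumes "p \<ge> 1" "a \<ge> 0" "b \<ge> 0" "a + b = 1" "r \<ge> 0" "s \<ge> 0"
  shows "(a * r + b * s) powr p \<le> a * r powr p + b * s powr p"
proof -
  \<comment> \<open>A factor \<open>c\<close> in (0, 1] satisfies \<open>c powr p \<le> c\<close>
    because the exponent is at least 1.\<close>
  have scale: "(c * t) powr p \<le> c * t powr p" if "c \<ge> 0" "c \<le> 1" "t \<ge> 0" for c t :: real
  proof (cases "c = 0")
    case False
    then have "c powr p \<le> c"
      using that \<open>p \<ge> 1\<close> by (simp add: powr_le_one_le)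
    then show ?thesis
      using that by (simp add: powr_mult mult_right_mono)
  qed simp
  show ?thesis
  proof (cases "r = 0 \<or> s = 0")
    case True
    then show ?thesis
      using assms scale[of a r] scale[of b s] by auto
  next
    case False
    then show ?thesis
      using assms powr_convex[OF \<open>p \<ge> 1\<close>] by (auto simp: convex_on_def)
  qed
qed

lemma nonexpansive_wrt_mean_pair:
  fixes C :: "'a::real_normed_vector set"
  assumes p: "p \<ge> 1" and a: "\<alpha>1 \<ge> 0" "\<alpha>2 \<ge> 0" "\<alpha>1 + \<alpha>2 = 1"
    and C: "convex C" and T: "mean_nonexpansive_on \<alpha>1 \<alpha>2 p C T"
  shows "nonexpansive_wrt (weighted_norm \<alpha>1 \<alpha>2 p) (C \<times> C)
           (\<lambda>u. let z = \<alpha>1 *\<^sub>R fst u + \<alpha>2 *\<^sub>R snd u in (T z, (T \<circ> T) z))"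
proof -
  have "weighted_norm \<alpha>1 \<alpha>2 p ((T z, (T \<circ> T) z) - (T w, (T \<circ> T) w))
          \<le> weighted_norm \<alpha>1 \<alpha>2 p (u - v)"
    if u: "u \<in> C \<times> C" and v: "v \<in> C \<times> C"
      and z: "z = \<alpha>1 *\<^sub>R fst u + \<alpha>2 *\<^sub>R snd u" and w: "w = \<alpha>1 *\<^sub>R fst v + \<alpha>2 *\<^sub>R snd v"
    for u v z w
  proof -
    have "z \<in> C" "w \<in> C"
      using u v a C by (auto simp: z w intro: convexD)
    then have "\<alpha>1 * norm (T z - T w) powr p + \<alpha>2 * norm ((T \<circ> T) z - (T \<circ> T) w) powr p
                 \<le> norm (z - w) powr p"
      using T by (auto simp: mean_nonexpansive_on_def)
    \<comment> \<open>The triangle inequality reduces the vector estimate to a weighted mean of two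
      real distances, to which scalar convexity applies.\<close>
    also have "\<dots> \<le> (\<alpha>1 * norm (fst u - fst v) + \<alpha>2 * norm (snd u - snd v)) powr p"
    proof (rule powr_mono2)
      have "z - w = \<alpha>1 *\<^sub>R (fst u - fst v) + \<alpha>2 *\<^sub>R (snd u - snd v)"
        by (simp add: z w algebra_simps)
      then show "norm (z - w) \<le> \<alpha>1 * norm (fst u - fst v) + \<alpha>2 * norm (snd u - snd v)"
        using a by (metis abs_of_nonneg norm_scaleR norm_triangle_ineq)
    qed (use p in auto)
    also have "\<dots> \<le> \<alpha>1 * norm (fst u - fst v) powr p + \<alpha>2 * norm (snd u - snd v) powr p"
      using p a by (intro powr_convex_combination_le) auto
    finally show ?thesis
      \<comment> \<open>The estimate so far concerns \<open>p\<close>-th powers; raising to the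
        positive exponent \<open>1 / p\<close> is monotone on nonnegative reals.\<close>
      unfolding weighted_norm_def using p a by (intro powr_mono2) auto
  qed
  then show ?thesis
    \<comment> \<open>Keeping \<open>T \<circ> T\<close> folded lets the goal match the inequality
      above.\<close>
    by (simp add: nonexpansive_wrt_def Let_def del: o_apply)
qed

theorem corollary3p2:
  fixes C :: "'a::banach set" and T :: "'a \<Rightarrow> 'a" and p \<alpha>1 \<alpha>2 :: real
  assumes "p \<ge> 1"
    and "\<alpha>1 > 0" and "\<alpha>2 > 0" and "\<alpha>1 + \<alpha>2 = 1"
    and "C \<noteq> {}" and "closed C" and "bounded C" and "convex C"
    and "fixed_point_property (weighted_norm \<alpha>1 \<alpha>2 p) (C \<times> C)"
    and "mean_nonexpansive_on \<alpha>1 \<alpha>2 p C T"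
  shows "(\<exists>x\<in>C. \<exists>y\<in>C.
            T (\<alpha>1 *\<^sub>R x + \<alpha>2 *\<^sub>R y) = x \<and>
            (T \<circ> T) (\<alpha>1 *\<^sub>R x + \<alpha>2 *\<^sub>R y) = y \<and>
            T x = y \<and>
            T (\<alpha>1 *\<^sub>R x + \<alpha>2 *\<^sub>R T x) = x \<and>
            tau \<alpha>1 \<alpha>2 T x = x)"
proof -
  define J where "J u = (let z = \<alpha>1 *\<^sub>R fst u + \<alpha>2 *\<^sub>R snd u in (T z, (T \<circ> T) z))" for u
  have "nonexpansive_wrt (weighted_norm \<alpha>1 \<alpha>2 p) (C \<times> C) J"
    unfolding J_def using assms by (intro nonexpansive_wrt_mean_pair) auto
  moreover have "J \<in> C \<times> C \<rightarrow> C \<times> C"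
  proof
    fix u assume "u \<in> C \<times> C"
    then have "\<alpha>1 *\<^sub>R fst u + \<alpha>2 *\<^sub>R snd u \<in> C"
      using assms by (auto intro: convexD)
    moreover have "T \<in> C \<rightarrow> C"
      using assms by (simp add: mean_nonexpansive_on_def)
    ultimately show "J u \<in> C \<times> C"
      by (auto simp: J_def Let_def)
  qed
  ultimately obtain x y where "x \<in> C" "y \<in> C" "J (x, y) = (x, y)"
    using assms(9) unfolding fixed_point_property_def by blast
  then have x: "T (\<alpha>1 *\<^sub>R x + \<alpha>2 *\<^sub>R y) = x" and y: "(T \<circ> T) (\<alpha>1 *\<^sub>R x + \<alpha>2 *\<^sub>R y) = y"
    by (auto simp: J_def Let_def)
  then have "T x = y"
    by simp
  \<comment> \<open>Substituting \<open>T x\<close> for \<open>y\<close> in the equation for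
    \<open>x\<close> gives the fixed point of \<open>tau\<close>.\<close>
  with x y \<open>x \<in> C\<close> \<open>y \<in> C\<close> show ?thesis
    by (auto simp: tau_def)
qed

end
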